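(* Let $f:\mathbb{R}^{d_x}\to\mathbb{R}$ be $\mu_x$-strongly convex and $L_x$-smooth and let $g:\mathbb{R}^{d_y}\to\mathbb{R}$ be $\mu_y$-strongly convex and $L_y$-smooth, with $\mu_x,\mu_y>0$. Let $\mathbf{A}\in\mathbb{R}^{d_y\times d_x}$, and let $L_{xy}>0$, $\mu_{xy},\mu_{yx}\ge 0$ satisfy the coupling-matrix assumption given in the context. Let $(x^*,y^* )$ be the saddle point of $\min_x\max_y f(x)+y^\top\mathbf{A}x-g(y)$. Suppose we have access to an oracle returning at each $x\in\mathbb{R}^{d_x}$ a $(\delta_x,L_x,\mu_x)$-model $\nabla f_\delta(x)$ of $f$ at $x$, and an oracle returning at each $y\in\mathbb{R}^{d_y}$ a $(\delta_y,L_y,\mu_y)$-model $\nabla g_\delta(y)$ of $g$ at $y$. Then there exist parameters $\eta_x,\eta_y,\alpha_x,\alpha_y,\beta_x,\beta_y>0$, $\tau_x,\tau_y,\sigma_x,\sigma_y\in(0,1]$, $\theta\in(0,1)$ such that the iterates of the Inexact APDG algorithm (described in the context) satisfy, for all $k\ge 0$, $$\|x^k-x^*\|^2\le\frac{1}{3L_{xy}}\sqrt{\frac{\mu_y}{\mu_x}}\left(\theta^k\Psi^0+\frac{4}{(1-\theta)^2}(\delta_x+\delta_y)\right),$$ $$\|y^k-y^*\|^2\le\frac{1}{4L_{xy}}\sqrt{\frac{\mu_x}{\mu_y}}\left(\theta^k\Psi^0+\frac{4}{(1-\theta)^2}(\delta_x+\delta_y)\right),$$ and $$\frac{1}{1-\theta}\le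 4+4\max\left\{\sqrt{\frac{L_x}{\mu_x}},\sqrt{\frac{L_y}{\mu_y}},\frac{L_{xy}}{\sqrt{\mu_x\mu_y}}\right\},$$ where $\Psi^0=\frac{1}{\eta_x}\|x^0-x^*\|^2+\frac{1}{\eta_y}\|y^0-y^*\|^2+\frac{2}{\sigma_x}B_f(x^0,x^* )+\frac{2}{\sigma_y}B_g(y^0,y^* )$.
   Context: Norms are Euclidean. A differentiable function $h$ is $L$-smooth if $\|\nabla h(y)-\nabla h(x)\|\le L\|y-x\|$ for all $x,y$, and $\mu$-strongly convex if $h(y)\ge h(x)+\langle\nabla h(x),y-x\rangle+\frac{\mu}{2}\|y-x\|^2$ for all $x,y$. $B_h(x,x')=h(x)-h(x')-\langle\nabla h(x'),x-x'\rangle$ is the Bregman divergence. **Inexact model.** Let $\delta\ge 0$. A vector $s$ is a $(\delta,L,\mu)$-model of $h:\mathbb{R}^m\to\mathbb{R}$ at the point $x$ if there is a number $c\in\mathbb{R}$ such that for all $y\in\mathbb{R}^m$: $\frac{\mu}{2}\|y-x\|^2\le h(y)-(c+\langle s,y-x\rangle)\le\frac{L}{2}\|y-x\|^2+\delta$. **Coupling-matrix assumption.** $L_{xy}^2\ge\lambda_{\max}(\mathbf{A}^\top\mathbf{A})=\lambda_{\max}(\mathbf{A}\mathbf{A}^\top)$. Further, $\mu_{xy}^2\le\lambda_{\min}^+(\mathbf{A}\mathbf{A}^\top)$ if the gradients of $g$ and all outputs of the oracle for $g$ lie in $\mathrm{range}\,\mathbf{A}$, and $\mu_{xy}^2\le\lambda_{\min}(\mathbf{A}\mathbf{A}^\top)$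 otherwise; $\mu_{yx}^2\le\lambda_{\min}^+(\mathbf{A}^\top\mathbf{A})$ if the gradients of $f$ and all outputs of the oracle for $f$ lie in $\mathrm{range}\,\mathbf{A}^\top$, and $\mu_{yx}^2\le\lambda_{\min}(\mathbf{A}^\top\mathbf{A})$ otherwise. Here $\lambda_{\min},\lambda_{\min}^+,\lambda_{\max}$ are the smallest, smallest positive and largest eigenvalues. **Inexact APDG.** Start from $x_f^0=x^0\in\mathrm{range}\,\mathbf{A}^\top$ and $y_f^0=y^{-1}=y^0\in\mathrm{range}\,\mathbf{A}$. For $k=0,1,2,\dots$: - $y_m^k=y^k+\theta(y^k-y^{k-1})$; - $x_g^k=\tau_xx^k+(1-\tau_x)x_f^k$, $\quad y_g^k=\tau_yy^k+(1-\tau_y)y_f^k$; - $x^{k+1}=x^k+\eta_x\alpha_x(x_g^k-x^k)-\eta_x\beta_x\mathbf{A}^\top(\mathbf{A}x^k-\nabla g_\delta(y_g^k))-\eta_x(\nabla f_\delta(x_g^k)+\mathbf{A}^\top y_m^k)$; - $y^{k+1}=y^k+\eta_y\alpha_y(y_g^k-y^k)-\eta_y\beta_y\mathbf{A}(\mathbf{A}^\top y^k+\nabla f_\delta(x_g^k))-\eta_y(\nabla g_\delta(y_g^k)-\mathbf{A}x^{k+1})$; - $x_f^{k+1}=x_g^k+\sigma_x(x^{k+1}-x^k)$, $\quad y_f^{k+1}=y_g^k+\sigma_y(y^{k+1}-y^k)$. *)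

theory Defs
  imports "HOL-Analysis.Analysis"
begin

text \<open>Only meaningful where the function is differentiable; the definitions below assume
  differentiability everywhere.\<close>
definition gradient :: "('a::real_inner \<Rightarrow> real) \<Rightarrow> 'a \<Rightarrow> 'a" where
  "gradient h x = (THE D. GDERIV h x :> D)"

lemma gradient_eqI:
  assumes "GDERIV h x :> D"
  shows "gradient h x = D"
  unfolding gradient_def
proof (rule the_equality)
  show "GDERIV h x :> D" by fact
next
  fix D' assume "GDERIV h x :> D'"
  with assms have "(\<lambda>v. v \<bullet> D') = (\<lambda>v. v \<bullet> D)"
    unfolding gderiv_def by (rule has_derivative_unique[rotated])
  then have "(D' - D) \<bullet> D' = (D' - D) \<bullet> D" by (rule fun_cong)
  then have "(D' - D) \<bullet> (D' - D) = 0" by (simp add: inner_diff_right)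
  then show "D' = D" by simp
qed

definition L_smooth :: "real \<Rightarrow> ('a::euclidean_space \<Rightarrow> real) \<Rightarrow> bool" where
  "L_smooth L h \<longleftrightarrow>
     (\<forall>x. h differentiable at x) \<and>
     (\<forall>x y. norm (gradient h y - gradient h x) \<le> L * norm (y - x))"

definition strongly_convex :: "real \<Rightarrow> ('a::euclidean_space \<Rightarrow> real) \<Rightarrow> bool" where
  "strongly_convex \<mu> h \<longleftrightarrow>
     (\<forall>x. h differentiable at x) \<and>
     (\<forall>x y. h y \<ge> h x + gradient h x \<bullet> (y - x) + \<mu> / 2 * (norm (y - x))\<^sup>2)"

definition bregman :: "('a::euclidean_space \<Rightarrow> real) \<Rightarrow> 'a \<Rightarrow> 'a \<Rightarrow> real" where
  "bregman h x x' = h x - h x' - gradient h x' \<bullet> (x - x')"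

definition is_model ::
  "real \<Rightarrow> real \<Rightarrow> real \<Rightarrow> ('a::euclidean_space \<Rightarrow> real) \<Rightarrow> 'a \<Rightarrow> 'a \<Rightarrow> bool" where
  "is_model \<delta> L \<mu> h x s \<longleftrightarrow>
     (\<exists>c. \<forall>y. \<mu> / 2 * (norm (y - x))\<^sup>2 \<le> h y - (c + s \<bullet> (y - x)) \<and>
               h y - (c + s \<bullet> (y - x)) \<le> L / 2 * (norm (y - x))\<^sup>2 + \<delta>)"

definition saddle_point :: "('a \<Rightarrow> 'b \<Rightarrow> real) \<Rightarrow> 'a \<Rightarrow> 'b \<Rightarrow> bool" where
  "saddle_point F x y \<longleftrightarrow> (\<forall>x' y'. F x y' \<le> F x y \<and> F x y \<le> F x' y)"

definition eigenvalues :: "real ^ 'n ^ 'n \<Rightarrow> real set" where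
  "eigenvalues M = {c. \<exists>v. v \<noteq> 0 \<and> M *v v = c *\<^sub>R v}"

text \<open>These are applied only to the symmetric matrices \<open>A ** transpose A\<close> and
  \<open>transpose A ** A\<close>, whose sets of eigenvalues are finite and nonempty. For \<open>A = 0\<close> there is no
  positive eigenvalue and \<open>lambda_min_pos\<close> is unspecified; in the coupling assumption this cannot
  occur, since the gradient of a smooth strongly convex function is not confined to \<open>{0}\<close>.\<close>

definition lambda_max :: "real ^ 'n ^ 'n \<Rightarrow> real" where
  "lambda_max M = Max (eigenvalues M)"

definition lambda_min :: "real ^ 'n ^ 'n \<Rightarrow> real" where
  "lambda_min M = Min (eigenvalues M)"

definition lambda_min_pos :: "real ^ 'n ^ 'n \<Rightarrow> real" where
  "lambda_min_pos M = Min {c \<in> eigenvalues M. c > 0}"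

definition mat_range :: "real ^ 'n ^ 'm \<Rightarrow> (real ^ 'm) set" where
  "mat_range A = range (\<lambda>x. A *v x)"

definition coupling_assumption ::
  "real ^ 'n ^ 'm \<Rightarrow> (real ^ 'n \<Rightarrow> real) \<Rightarrow> (real ^ 'm \<Rightarrow> real)
    \<Rightarrow> (real ^ 'n \<Rightarrow> real ^ 'n) \<Rightarrow> (real ^ 'm \<Rightarrow> real ^ 'm)
    \<Rightarrow> real \<Rightarrow> real \<Rightarrow> real \<Rightarrow> bool" where
  "coupling_assumption A f g f\<delta> g\<delta> Lxy \<mu>xy \<mu>yx \<longleftrightarrow>
     Lxy\<^sup>2 \<ge> lambda_max (transpose A ** A) \<and>
     (if \<forall>y. gradient g y \<in> mat_range A \<and> g\<delta> y \<in> mat_range A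
      then \<mu>xy\<^sup>2 \<le> lambda_min_pos (A ** transpose A)
      else \<mu>xy\<^sup>2 \<le> lambda_min (A ** transpose A)) \<and>
     (if \<forall>x. gradient f x \<in> mat_range (transpose A) \<and> f\<delta> x \<in> mat_range (transpose A)
      then \<mu>yx\<^sup>2 \<le> lambda_min_pos (transpose A ** A)
      else \<mu>yx\<^sup>2 \<le> lambda_min (transpose A ** A))"

record apdg_params =
  eta_x :: real
  eta_y :: real
  alpha_x :: real
  alpha_y :: real
  beta_x :: real
  beta_y :: real
  tau_x :: real
  tau_y :: real
  sigma_x :: real
  sigma_y :: real
  theta :: real

definition admissible_params :: "apdg_params \<Rightarrow> bool" where
  "admissible_params p \<longleftrightarrow>
     0 < eta_x p \<and> 0 < eta_y p \<and> 0 < alpha_x p \<and> 0 < alpha_y p \<and> 0 < beta_x p \<and> 0 < beta_y p \<and>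
     tau_x p \<in> {0<..1} \<and> tau_y p \<in> {0<..1} \<and> sigma_x p \<in> {0<..1} \<and> sigma_y p \<in> {0<..1} \<and>
     theta p \<in> {0<..<1}"

text \<open>The sequences \<open>x, y, xf, yf\<close> are the iterates of Inexact APDG with oracles \<open>f\<delta>, g\<delta>\<close>
  (standing for \<open>\<nabla>f\<^sub>\<delta>, \<nabla>g\<^sub>\<delta>\<close>) started from \<open>x 0, y 0\<close>, which determine them uniquely.
  The convention \<open>y\<^sup>-\<^sup>1 = y\<^sup>0\<close> is built into \<open>yprev\<close>.\<close>
definition inexact_apdg ::
  "apdg_params \<Rightarrow> real ^ 'n ^ 'm \<Rightarrow> (real ^ 'n \<Rightarrow> real ^ 'n) \<Rightarrow> (real ^ 'm \<Rightarrow> real ^ 'm)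
    \<Rightarrow> (nat \<Rightarrow> real ^ 'n) \<Rightarrow> (nat \<Rightarrow> real ^ 'm) \<Rightarrow> (nat \<Rightarrow> real ^ 'n) \<Rightarrow> (nat \<Rightarrow> real ^ 'm) \<Rightarrow> bool"
  where
  "inexact_apdg p A f\<delta> g\<delta> x y xf yf \<longleftrightarrow>
     x 0 \<in> mat_range (transpose A) \<and> xf 0 = x 0 \<and>
     y 0 \<in> mat_range A \<and> yf 0 = y 0 \<and>
     (\<forall>k. let yprev = (if k = 0 then y 0 else y (k - 1));
              ym = y k + theta p *\<^sub>R (y k - yprev);
              xg = tau_x p *\<^sub>R x k + (1 - tau_x p) *\<^sub>R xf k;
              yg = tau_y p *\<^sub>R y k + (1 - tau_y p) *\<^sub>R yf k
          in x (Suc k) = x k + (eta_x p * alpha_x p) *\<^sub>R (xg - x k)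
               - (eta_x p * beta_x p) *\<^sub>R (transpose A *v (A *v x k - g\<delta> yg))
               - eta_x p *\<^sub>R (f\<delta> xg + transpose A *v ym) \<and>
             y (Suc k) = y k + (eta_y p * alpha_y p) *\<^sub>R (yg - y k)
               - (eta_y p * beta_y p) *\<^sub>R (A *v (transpose A *v y k + f\<delta> xg))
               - eta_y p *\<^sub>R (g\<delta> yg - A *v x (Suc k)) \<and>
             xf (Suc k) = xg + sigma_x p *\<^sub>R (x (Suc k) - x k) \<and>
             yf (Suc k) = yg + sigma_y p *\<^sub>R (y (Suc k) - y k))"

definition Psi0 ::
  "apdg_params \<Rightarrow> ('a::euclidean_space \<Rightarrow> real) \<Rightarrow> ('b::euclidean_space \<Rightarrow> real)
    \<Rightarrow> 'a \<Rightarrow> 'b \<Rightarrow> 'a \<Rightarrow> 'b \<Rightarrow> real" where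
  "Psi0 p f g x0 y0 xs ys =
     1 / eta_x p * (norm (x0 - xs))\<^sup>2 + 1 / eta_y p * (norm (y0 - ys))\<^sup>2
     + 2 / sigma_x p * bregman f x0 xs + 2 / sigma_y p * bregman g y0 ys"

end

theory Submission
  imports Defs
begin

text \<open>
  Write \<open>M\<close> for the maximum in the rate bound; \<open>M \<ge> 1\<close>, since a model with curvatures \<open>\<mu>\<close> and
  \<open>L\<close> forces \<open>\<mu> \<le> L\<close>. With the strong convexity constants given, \<open>M\<close> alone
  determines the main parameters:
  \<open>\<eta> = 1 / (4M\<mu>)\<close>, \<open>\<alpha> = \<mu>\<close>, \<open>\<sigma> = 1 / (2M)\<close>, \<open>1 / \<tau> = 1 / \<sigma> + 1 / 2\<close> for each of the two blocks,
  and \<open>\<theta> = 1 - 1 / (4M)\<close>, so that \<open>1 / (1 - \<theta>) = 4M\<close>. The constants \<open>\<beta>\<close> only have to be positive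
  and small.

  The proof shows that an energy contracts by the factor \<open>\<theta>\<close> up to an additive error. The energy is
  the weighted squared distance \<open>\<parallel>x - x\<^sup>*\<parallel>\<^sup>2 / \<eta>\<^sub>x + \<parallel>y - y\<^sup>*\<parallel>\<^sup>2 / \<eta>\<^sub>y\<close>, plus \<open>2 / \<sigma>\<close> times the Bregman
  divergences at \<open>x\<^sub>f\<close> and \<open>y\<^sub>f\<close>, plus two terms in \<open>y\<^sup>k - y\<^sup>k\<^sup>-\<^sup>1\<close> that pay for the extrapolated dual
  point \<open>y\<^sub>m\<close>.

  Each block on its own makes an accelerated gradient step: testing the model at \<open>z\<^sub>f\<close>, at the next
  \<open>z\<^sub>f\<close>, at the solution and at the query point gives \<open>accelerated_step\<close>. Two kinds of terms remain.
  The bilinear terms of the blocks add up to a difference of consecutive values of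
  \<open>2 (y\<^sup>k - y\<^sup>k\<^sup>-\<^sup>1) \<bullet> A (x\<^sup>k - x\<^sup>*)\<close>, the earlier one with factor \<open>\<theta>\<close>, and a remainder. The corrections with factor \<open>\<beta>\<close> compare the
  coupling with an inexact gradient of the other block; the squared error of that gradient
  is bounded by the Bregman divergence at the query point (\<open>model_gradient_error\<close>), and the term
  \<open>1 / 2\<close> in \<open>1 / \<tau>\<close> leaves exactly one such divergence to spend. Everything else is absorbed by the
  negative multiples of \<open>\<parallel>x\<^sup>k\<^sup>+\<^sup>1 - x\<^sup>k\<parallel>\<^sup>2\<close> and \<open>\<parallel>y\<^sup>k\<^sup>+\<^sup>1 - y\<^sup>k\<parallel>\<^sup>2\<close>, because
  \<open>L\<^sub>x\<sigma> \<le> M\<mu>\<^sub>x / 2\<close>, \<open>L\<^sub>y\<sigma> \<le> M\<mu>\<^sub>y / 2\<close>, and the coupling constants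
  \<open>P = L\<^sub>x\<^sub>y \<surd>(\<mu>\<^sub>x / \<mu>\<^sub>y)\<close> and \<open>Q = L\<^sub>x\<^sub>y \<surd>(\<mu>\<^sub>y / \<mu>\<^sub>x)\<close> are at most \<open>M\<mu>\<^sub>x\<close> and \<open>M\<mu>\<^sub>y\<close>. This is
  \<open>apdg_energy_step\<close>.

  The energy dominates \<open>3P \<parallel>x - x\<^sup>*\<parallel>\<^sup>2 + 4Q \<parallel>y - y\<^sup>*\<parallel>\<^sup>2\<close> (\<open>apdg_energy_lower_bound\<close>), and its initial value is
  \<open>\<Psi>\<^sup>0\<close>. The error of one step is \<open>(4M + 2) (\<delta>\<^sub>x + \<delta>\<^sub>y)\<close>, at most \<open>4 / (1 - \<theta>)\<close> times
  \<open>\<delta>\<^sub>x + \<delta>\<^sub>y\<close>, and summing the geometric series costs one more factor \<open>1 / (1 - \<theta>)\<close>.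
\<close>

section \<open>The operator norm and the largest eigenvalue\<close>

text \<open>Eigenvectors of a symmetric matrix for distinct eigenvalues are orthogonal, and a Euclidean space
  has no infinite orthogonal family. Finiteness makes the maximum in \<open>lambda_max\<close> meaningful.\<close>

lemma finite_eigenvalues_symmetric:
  fixes B :: "real ^ 'n ^ 'n"
  assumes sym: "transpose B = B"
  shows "finite (eigenvalues B)"
proof -
  have "\<forall>c\<in>eigenvalues B. \<exists>v. v \<noteq> 0 \<and> B *v v = c *\<^sub>R v"
    by (auto simp: eigenvalues_def)
  then obtain w where w: "\<And>c. c \<in> eigenvalues B \<Longrightarrow> w c \<noteq> 0 \<and> B *v w c = c *\<^sub>R w c"
    by metis
  have orth: "w c \<bullet> w d = 0" if "c \<in> eigenvalues B" "d \<in> eigenvalues B" "c \<noteq> d" for c d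
  proof -
    have "c * (w c \<bullet> w d) = (B *v w c) \<bullet> w d"
      using w that by simp
    also have "\<dots> = w c \<bullet> (B *v w d)"
      by (metis dot_lmul_matrix sym transpose_matrix_vector)
    also have "\<dots> = d * (w c \<bullet> w d)"
      using w that by simp
    finally show ?thesis using that by simp
  qed
  have "pairwise orthogonal (w ` eigenvalues B)"
    by (auto simp: pairwise_def orthogonal_def intro!: orth)
  then have "finite (w ` eigenvalues B)"
    by (rule pairwise_orthogonal_imp_finite)
  moreover have "inj_on w (eigenvalues B)"
    by (rule inj_onI) (metis orth inner_eq_zero_iff w)
  ultimately show ?thesis by (simp add: finite_image_iff)
qed

text \<open>The quadratic form attains its maximum over the unit sphere, by compactness. A maximizer \<open>u\<close> is an
  eigenvector: otherwise the residual \<open>w = q(u) u - B u\<close> is a direction in which a small step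
  violates \<open>q(v) \<le> q(u) \<parallel>v\<parallel>\<^sup>2\<close> to first order.\<close>

lemma quadratic_form_le_lambda_max:
  fixes B :: "real ^ 'n ^ 'n"
  assumes sym: "transpose B = B"
  shows "v \<bullet> (B *v v) \<le> lambda_max B * (norm v)\<^sup>2"
proof -
  define q where "q u = u \<bullet> (B *v u)" for u
  have cont: "continuous_on (sphere 0 1) q"
    unfolding q_def by (intro continuous_intros linear_continuous_on_compose
        matrix_vector_mul_linear continuous_on_id)
  have "\<exists>u. u \<in> sphere (0 :: real ^ 'n) 1"
    using vector_choose_size[of 1] by (auto simp: dist_norm)
  then obtain u where u: "norm u = 1" and u_max: "\<And>w. norm w = 1 \<Longrightarrow> q w \<le> q u"
    using continuous_attains_sup[OF compact_sphere _ cont] by (auto simp: dist_norm)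
  have le: "q w \<le> q u * (norm w)\<^sup>2" for w
  proof (cases "w = 0")
    case False
    have "q ((1 / norm w) *\<^sub>R w) \<le> q u" by (rule u_max) (use False in simp)
    moreover have "q ((1 / norm w) *\<^sub>R w) = q w / (norm w)\<^sup>2"
      by (simp add: q_def matrix_vector_mult_scaleR power2_eq_square)
    ultimately show ?thesis using False by (simp add: field_simps)
  qed (simp add: q_def)
  define w where "w = q u *\<^sub>R u - B *v u"
  have swap: "u \<bullet> (B *v w) = w \<bullet> (B *v u)"
    by (metis dot_lmul_matrix inner_commute sym transpose_matrix_vector)
  have ww: "w \<bullet> w = q u * (u \<bullet> w) - w \<bullet> (B *v u)"
    by (simp add: w_def inner_diff_left inner_diff_right inner_commute algebra_simps)
  define k where "k = q u * (norm w)\<^sup>2 - q w"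
  have k0: "k \<ge> 0" using le[of w] by (simp add: k_def)
  have perturb: "2 * t * (w \<bullet> w) \<le> t\<^sup>2 * k" for t
  proof -
    have u1: "u \<bullet> u = 1" using u by (simp add: dot_square_norm)
    have "q (u - t *\<^sub>R w) = q u - 2 * t * (w \<bullet> (B *v u)) + t\<^sup>2 * q w"
      using swap by (simp add: q_def matrix_vector_mult_diff_distrib matrix_vector_mult_scaleR
          inner_diff_left inner_diff_right power2_eq_square algebra_simps)
    moreover have "(norm (u - t *\<^sub>R w))\<^sup>2 = 1 - 2 * t * (u \<bullet> w) + t\<^sup>2 * (norm w)\<^sup>2"
      using u1 unfolding power2_norm_eq_inner
      by (simp add: inner_diff_left inner_diff_right power2_eq_square inner_commute algebra_simps)
    ultimately have "q u - 2 * t * (w \<bullet> (B *v u)) + t\<^sup>2 * q w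
        \<le> q u * (1 - 2 * t * (u \<bullet> w) + t\<^sup>2 * (norm w)\<^sup>2)"
      using le[of "u - t *\<^sub>R w"] by simp
    moreover have "w \<bullet> (B *v u) = q u * (u \<bullet> w) - w \<bullet> w" using ww by simp
    ultimately show ?thesis by (simp only: k_def) (simp add: algebra_simps)
  qed
  have "w \<bullet> w = 0"
  proof (rule ccontr)
    assume "w \<bullet> w \<noteq> 0"
    then have pos: "w \<bullet> w > 0" by simp
    \<comment> \<open>The right side of the inequality is of second order in \<open>t\<close>; this \<open>t\<close> is small enough.\<close>
    define t where "t = w \<bullet> w / (k + 1)"
    have t: "t > 0" "w \<bullet> w = t * (k + 1)" using pos k0 by (auto simp: t_def)
    have "t\<^sup>2 * (2 * (k + 1)) \<le> t\<^sup>2 * k"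
      using perturb[of t] unfolding t(2) by (simp add: power2_eq_square mult_ac)
    then have "2 * (k + 1) \<le> k" using t by (simp add: mult_le_cancel_left_pos)
    then show False using k0 by simp
  qed
  then have "B *v u = q u *\<^sub>R u" by (simp add: w_def)
  moreover have "u \<noteq> 0" using u by auto
  ultimately have "q u \<in> eigenvalues B" unfolding eigenvalues_def by auto
  then have "q u \<le> lambda_max B"
    unfolding lambda_max_def by (intro Max_ge finite_eigenvalues_symmetric sym)
  then have "q u * (norm v)\<^sup>2 \<le> lambda_max B * (norm v)\<^sup>2" by (intro mult_right_mono) auto
  then show ?thesis using le[of v] by (simp add: q_def)
qed

lemma inner_transpose_matrix:
  fixes A :: "real ^ 'n ^ 'm"
  shows "(transpose A *v y) \<bullet> x = y \<bullet> (A *v x)"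
  by (simp add: dot_lmul_matrix)

lemma norm_matrix_le_of_lambda_max:
  fixes A :: "real ^ 'n ^ 'm"
  assumes "lambda_max (transpose A ** A) \<le> c\<^sup>2" and "c \<ge> 0"
  shows "norm (A *v v) \<le> c * norm v"
proof -
  have "(norm (A *v v))\<^sup>2 = v \<bullet> ((transpose A ** A) *v v)"
    by (metis inner_commute inner_transpose_matrix matrix_vector_mul_assoc power2_norm_eq_inner)
  also have "\<dots> \<le> lambda_max (transpose A ** A) * (norm v)\<^sup>2"
    by (rule quadratic_form_le_lambda_max) (simp add: matrix_transpose_mul transpose_transpose)
  also have "\<dots> \<le> (c * norm v)\<^sup>2"
    using assms by (simp add: power_mult_distrib mult_right_mono)
  finally show ?thesis
    using assms by (simp add: power2_le_iff_abs_le)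
qed

lemma norm_transpose_le:
  fixes A :: "real ^ 'n ^ 'm"
  assumes bound: "\<And>x. norm (A *v x) \<le> c * norm x"
  shows "norm (transpose A *v y) \<le> c * norm y"
proof (cases "transpose A *v y = 0")
  case True
  have "0 \<le> c * norm (axis undefined 1 :: real ^ 'n)"
    using bound norm_ge_zero order_trans by blast
  then show ?thesis using True by simp
next
  case False
  let ?w = "transpose A *v y"
  have "norm ?w * norm ?w = y \<bullet> (A *v ?w)"
    by (metis inner_transpose_matrix dot_square_norm power2_eq_square)
  also have "\<dots> \<le> norm y * norm (A *v ?w)" by (rule norm_cauchy_schwarz)
  also have "\<dots> \<le> norm y * (c * norm ?w)" by (intro mult_left_mono bound) simp
  finally have "norm ?w * norm ?w \<le> (c * norm y) * norm ?w" by (simp add: mult_ac)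
  then show ?thesis using False by (simp add: mult_le_cancel_right)
qed

text \<open>The weights \<open>P\<close> and \<open>Q\<close> split the constant of the bilinear form between the two blocks, to match
  their different strong convexity constants.\<close>

lemma coupling_bound:
  fixes A :: "real ^ 'n ^ 'm"
  assumes bound: "\<And>x. norm (A *v x) \<le> L * norm x" and "P > 0" "Q > 0" "P * Q = L\<^sup>2"
  shows "2 * \<bar>d \<bullet> (A *v v)\<bar> \<le> P * (norm v)\<^sup>2 + Q * (norm d)\<^sup>2"
proof -
  have "\<bar>d \<bullet> (A *v v)\<bar> \<le> norm d * norm (A *v v)" by (rule Cauchy_Schwarz_ineq2)
  also have "\<dots> \<le> norm d * (L * norm v)" by (intro mult_left_mono bound) simp
  also have "\<dots> \<le> \<bar>L\<bar> * (norm v * norm d)" by (simp add: mult_ac mult_right_mono)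
  also have "\<bar>L\<bar> = sqrt P * sqrt Q" using assms by (metis real_sqrt_abs real_sqrt_mult)
  also have "2 * (sqrt P * sqrt Q * (norm v * norm d)) = 2 * (sqrt P * norm v) * (sqrt Q * norm d)"
    by simp
  finally have *: "2 * \<bar>d \<bullet> (A *v v)\<bar> \<le> 2 * (sqrt P * norm v) * (sqrt Q * norm d)" by simp
  also have "\<dots> \<le> (sqrt P * norm v)\<^sup>2 + (sqrt Q * norm d)\<^sup>2" by (rule sum_squares_bound)
  finally show ?thesis using assms by (simp add: power_mult_distrib)
qed

section \<open>Gradients and inexact models\<close>

text \<open>In a Euclidean space the derivative is represented by an inner product, so \<open>gradient\<close> is the gradient.\<close>

lemma GDERIV_gradient:
  fixes h :: "'a::euclidean_space \<Rightarrow> real"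
  assumes "h differentiable at x"
  shows "GDERIV h x :> gradient h x"
proof -
  obtain D where D: "(h has_derivative D) (at x)" using assms by (auto simp: differentiable_def)
  then interpret D: linear D by (rule has_derivative_linear)
  have "D v = v \<bullet> (\<Sum>b\<in>Basis. D b *\<^sub>R b)" for v
  proof -
    have "D v = D (\<Sum>b\<in>Basis. (v \<bullet> b) *\<^sub>R b)" by (simp add: euclidean_representation)
    also have "\<dots> = (\<Sum>b\<in>Basis. (v \<bullet> b) * D b)" by (simp add: D.sum D.scale)
    finally show ?thesis by (simp add: inner_sum_right mult.commute)
  qed
  then have "GDERIV h x :> (\<Sum>b\<in>Basis. D b *\<^sub>R b)"
    using D unfolding gderiv_def by (metis (no_types, lifting) ext)
  then show ?thesis using gradient_eqI by metis
qed

lemma gradient_eq_at_minimum: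
  fixes h :: "'a::euclidean_space \<Rightarrow> real"
  assumes "h differentiable at x" and min: "\<And>z. h x - a \<bullet> x \<le> h z - a \<bullet> z"
  shows "gradient h x = a"
proof -
  have "(h has_derivative (\<lambda>v. v \<bullet> gradient h x)) (at x)"
    using GDERIV_gradient[OF assms(1)] by (simp add: gderiv_def)
  then have "((\<lambda>z. h z - a \<bullet> z) has_derivative (\<lambda>v. v \<bullet> gradient h x - a \<bullet> v)) (at x)"
    by (auto intro!: derivative_eq_intros)
  then have "(\<lambda>v. v \<bullet> gradient h x - a \<bullet> v) = (\<lambda>v. 0)"
    by (rule differential_zero_maxmin[where S = UNIV, rotated 2]) (use min in auto)
  then have "(gradient h x - a) \<bullet> gradient h x - a \<bullet> (gradient h x - a) = 0" by metis
  then have "(gradient h x - a) \<bullet> (gradient h x - a) = 0"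
    by (simp add: inner_diff_left inner_diff_right inner_commute)
  then show ?thesis by simp
qed

lemma bregman_nonneg:
  assumes "strongly_convex \<mu> h" "\<mu> \<ge> 0"
  shows "bregman h x x' \<ge> 0"
proof -
  have "0 \<le> \<mu> / 2 * (norm (x - x'))\<^sup>2" using assms by simp
  then show ?thesis
    using assms(1) unfolding strongly_convex_def bregman_def by smt
qed

lemma bregman_self [simp]: "bregman h x x = 0"
  by (simp add: bregman_def)

text \<open>Subtracting the linearization of \<open>h\<close> at a reference point from both \<open>h\<close> and its affine minorant
  leaves the error of the model unchanged. With the solution as reference point, the model is one of
  a nonnegative function that vanishes there.\<close>

lemma model_of_bregman:
  assumes "is_model \<delta> L \<mu> h x s"
  obtains c where
    "\<And>y. \<mu> / 2 * (norm (y - x))\<^sup>2 \<le> bregman h y x' - (c + (s - gradient h x') \<bullet> (y - x))"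
    "\<And>y. bregman h y x' - (c + (s - gradient h x') \<bullet> (y - x)) \<le> L / 2 * (norm (y - x))\<^sup>2 + \<delta>"
proof -
  obtain c where c: "\<And>y. \<mu> / 2 * (norm (y - x))\<^sup>2 \<le> h y - (c + s \<bullet> (y - x)) \<and>
      h y - (c + s \<bullet> (y - x)) \<le> L / 2 * (norm (y - x))\<^sup>2 + \<delta>"
    using assms unfolding is_model_def by blast
  have "bregman h y x' - ((c - h x' - gradient h x' \<bullet> (x - x')) + (s - gradient h x') \<bullet> (y - x))
      = h y - (c + s \<bullet> (y - x))" for y
    by (simp add: bregman_def inner_diff_left inner_diff_right)
  then show ?thesis using that c by metis
qed

text \<open>The gap between the two quadratic bounds stays below \<open>\<delta>\<close> at every distance.\<close>

lemma model_curvature_le: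
  fixes h :: "'a::euclidean_space \<Rightarrow> real"
  assumes "is_model \<delta> L \<mu> h x s"
  shows "\<mu> \<le> L"
proof (rule ccontr)
  assume "\<not> \<mu> \<le> L"
  then have pos: "\<mu> - L > 0" by simp
  obtain c where c: "\<And>y. \<mu> / 2 * (norm (y - x))\<^sup>2 \<le> h y - (c + s \<bullet> (y - x)) \<and>
      h y - (c + s \<bullet> (y - x)) \<le> L / 2 * (norm (y - x))\<^sup>2 + \<delta>"
    using assms unfolding is_model_def by blast
  have \<delta>: "0 \<le> \<delta>" using c[of x] by simp
  obtain v :: 'a where v: "norm v = sqrt (2 * (\<delta> + 1) / (\<mu> - L))"
    using vector_choose_size[of "sqrt (2 * (\<delta> + 1) / (\<mu> - L))"] pos \<delta> by auto
  have "(\<mu> - L) / 2 * (norm v)\<^sup>2 \<le> \<delta>"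
    using c[of "x + v"] by (simp add: algebra_simps)
  moreover have "(\<mu> - L) / 2 * (norm v)\<^sup>2 = \<delta> + 1"
    using pos \<delta> unfolding v by (simp add: field_simps)
  ultimately show False by simp
qed

text \<open>The gradient step of length \<open>1 / L\<close> along \<open>s - \<nabla>h(x')\<close> lowers the quadratic upper model of the
  Bregman divergence by the left side over \<open>2L\<close>, while the divergence itself stays nonnegative.\<close>

lemma model_gradient_error:
  fixes h :: "'a::euclidean_space \<Rightarrow> real"
  assumes model: "is_model \<delta> L \<mu> h x s" and conv: "strongly_convex \<mu> h" and "\<mu> > 0"
  shows "(norm (s - gradient h x'))\<^sup>2 \<le> 2 * L * (bregman h x x' + \<delta>)"
proof -
  define d where "d = s - gradient h x'"
  have L: "L > 0" using model_curvature_le[OF model] \<open>\<mu> > 0\<close> by simp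
  obtain c where c:
    "\<And>y. \<mu> / 2 * (norm (y - x))\<^sup>2 \<le> bregman h y x' - (c + d \<bullet> (y - x))"
    "\<And>y. bregman h y x' - (c + d \<bullet> (y - x)) \<le> L / 2 * (norm (y - x))\<^sup>2 + \<delta>"
    using model_of_bregman[OF model, of x'] unfolding d_def by blast
  define y where "y = x - (1 / L) *\<^sub>R d"
  have "d \<bullet> (y - x) = - ((norm d)\<^sup>2 / L)" by (simp add: y_def power2_norm_eq_inner)
  moreover have "L / 2 * (norm (y - x))\<^sup>2 = (norm d)\<^sup>2 / (2 * L)"
    using L by (simp add: y_def power_divide power2_eq_square)
  moreover have "0 \<le> bregman h y x'" using conv \<open>\<mu> > 0\<close> by (intro bregman_nonneg) auto
  moreover have "c \<le> bregman h x x'" using c(1)[of x] by simp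
  ultimately have "(norm d)\<^sup>2 / L - (norm d)\<^sup>2 / (2 * L) \<le> bregman h x x' + \<delta>"
    using c(2)[of y] by simp
  moreover have "(norm d)\<^sup>2 / L - (norm d)\<^sup>2 / (2 * L) = (norm d)\<^sup>2 / (2 * L)"
    using L by (simp add: field_simps)
  ultimately show ?thesis using L by (simp add: d_def field_simps)
qed

section \<open>Contraction within one block\<close>

text \<open>One step of the accelerated method for a single block. The vector \<open>w\<close> stands for everything in the
  update that comes from the coupling, measured relative to the solution. The relation between \<open>\<tau>\<close>
  and \<open>\<sigma>\<close> makes the constant \<open>c\<close> of the model enter with coefficient \<open>-1\<close>, which is the source of the term
  \<open>- bregman h zg zs\<close> on the right.\<close>

lemma accelerated_step:
  fixes h :: "'a::euclidean_space \<Rightarrow> real"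
  assumes model: "is_model \<delta> L \<mu> h zg s"
    and pos: "\<mu> > 0" "\<sigma> > 0" "\<sigma> \<le> 1" "\<tau> > 0" "\<eta> > 0"
    and tau: "1 / \<tau> = 1 / \<sigma> + 1 / 2"
    and zg: "zg = \<tau> *\<^sub>R z + (1 - \<tau>) *\<^sub>R zf"
    and z': "z' = z + (\<eta> * \<mu>) *\<^sub>R (zg - z) - \<eta> *\<^sub>R (s - gradient h zs) - \<eta> *\<^sub>R w"
    and zf': "zf' = zg + \<sigma> *\<^sub>R (z' - z)"
  shows "1 / \<eta> * (norm (z' - zs))\<^sup>2 + 2 / \<sigma> * bregman h zf' zs
    \<le> (1 / \<eta> - \<mu>) * (norm (z - zs))\<^sup>2 + (2 / \<sigma> - 1) * bregman h zf zs
      - (1 / \<eta> - \<mu> - L * \<sigma>) * (norm (z' - z))\<^sup>2 - bregman h zg zs + (2 / \<sigma> + 1) * \<delta>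
      - 2 * (w \<bullet> (z' - zs))"
proof -
  define d where "d = s - gradient h zs"
  obtain c where c:
    "\<And>y. \<mu> / 2 * (norm (y - zg))\<^sup>2 \<le> bregman h y zs - (c + d \<bullet> (y - zg))"
    "\<And>y. bregman h y zs - (c + d \<bullet> (y - zg)) \<le> L / 2 * (norm (y - zg))\<^sup>2 + \<delta>"
    using model_of_bregman[OF model, of zs] unfolding d_def by blast
  have three_point: "(norm (z' - zs))\<^sup>2
      = (norm (z - zs))\<^sup>2 - (norm (z' - z))\<^sup>2 + 2 * ((z' - z) \<bullet> (z' - zs))"
    by (simp add: power2_norm_eq_inner inner_diff_left inner_diff_right inner_commute)
  have "z' - z = \<eta> *\<^sub>R (\<mu> *\<^sub>R (zg - z) - d - w)"
    by (simp add: z' d_def algebra_simps)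
  then have move: "1 / \<eta> * ((z' - z) \<bullet> (z' - zs))
      = \<mu> * ((zg - z) \<bullet> (z' - zs)) - d \<bullet> (z' - zs) - w \<bullet> (z' - zs)"
    using pos by (simp add: inner_diff_left)
  have damp: "2 * ((zg - z) \<bullet> (z' - zs))
      \<le> (norm (zg - zs))\<^sup>2 - (norm (z - zs))\<^sup>2 + (norm (z' - z))\<^sup>2"
  proof -
    have "(norm (zg - zs))\<^sup>2 - (norm (z - zs))\<^sup>2 + (norm (z' - z))\<^sup>2
        - 2 * ((zg - z) \<bullet> (z' - zs)) = (norm (zg - z'))\<^sup>2"
      by (simp add: power2_norm_eq_inner inner_diff_left inner_diff_right inner_commute)
    then show ?thesis using zero_le_power2[of "norm (zg - z')"] by linarith
  qed
  \<comment> \<open>Expresses the displacement to the solution through the points at which the model is tested.\<close>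
  have split: "d \<bullet> (z' - zs)
      = 1 / \<sigma> * (d \<bullet> (zf' - zg)) - (1 / \<tau> - 1) * (d \<bullet> (zf - zg)) - d \<bullet> (zs - zg)"
  proof -
    have "\<tau> * (d \<bullet> (z - zg)) = - ((1 - \<tau>) * (d \<bullet> (zf - zg)))"
      by (simp add: zg inner_diff_right inner_add_right algebra_simps)
    then have "d \<bullet> (z - zg) = - ((1 / \<tau> - 1) * (d \<bullet> (zf - zg)))"
      using pos by (simp add: field_simps)
    moreover have "1 / \<sigma> * (d \<bullet> (zf' - zg)) = d \<bullet> (z' - z)"
      using pos by (simp add: zf')
    ultimately show ?thesis by (simp add: inner_diff_right)
  qed
  define a where "a = 1 / \<sigma>"
  have a: "a \<ge> 1" using pos by (simp add: a_def)
  have \<tau>: "1 / \<tau> - 1 = a - 1 / 2" using tau by (simp add: a_def)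
  have "- (d \<bullet> (zf' - zg))
      \<le> - bregman h zf' zs + c + L / 2 * (\<sigma>\<^sup>2 * (norm (z' - z))\<^sup>2) + \<delta>"
    using c(2)[of zf'] by (simp add: zf' power_mult_distrib)
  then have "2 * a * - (d \<bullet> (zf' - zg))
      \<le> 2 * a * (- bregman h zf' zs + c + L / 2 * (\<sigma>\<^sup>2 * (norm (z' - z))\<^sup>2) + \<delta>)"
    using a by (intro mult_left_mono) auto
  moreover have "2 * a * (L / 2 * (\<sigma>\<^sup>2 * (norm (z' - z))\<^sup>2)) = L * \<sigma> * (norm (z' - z))\<^sup>2"
    using pos by (simp add: a_def power2_eq_square)
  ultimately have at_zf': "2 * a * - (d \<bullet> (zf' - zg))
      \<le> 2 * a * - bregman h zf' zs + 2 * a * c + L * \<sigma> * (norm (z' - z))\<^sup>2 + 2 * a * \<delta>"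
    by (simp only: distrib_left)
  have "0 \<le> \<mu> / 2 * (norm (zf - zg))\<^sup>2" using pos by simp
  then have "c + d \<bullet> (zf - zg) \<le> bregman h zf zs" using c(1)[of zf] by linarith
  then have at_zf: "(2 * a - 1) * (c + d \<bullet> (zf - zg)) \<le> (2 * a - 1) * bregman h zf zs"
    using a by (intro mult_left_mono) auto
  have at_zs: "2 * c + 2 * (d \<bullet> (zs - zg)) \<le> - (\<mu> * (norm (zg - zs))\<^sup>2)"
    using c(1)[of zs] by (simp add: norm_minus_commute)
  have at_zg: "bregman h zg zs \<le> c + \<delta>"
    using c(2)[of zg] by simp
  have model_terms: "- 2 * (d \<bullet> (z' - zs))
      \<le> - (2 * a * bregman h zf' zs) + (2 * a - 1) * bregman h zf zs
        + L * \<sigma> * (norm (z' - z))\<^sup>2 - \<mu> * (norm (zg - zs))\<^sup>2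
        - bregman h zg zs + (2 * a + 1) * \<delta>"
    using at_zf' at_zf at_zs at_zg unfolding split \<tau> a_def[symmetric]
    by (simp add: algebra_simps)
  have "\<mu> * (2 * ((zg - z) \<bullet> (z' - zs)))
      \<le> \<mu> * ((norm (zg - zs))\<^sup>2 - (norm (z - zs))\<^sup>2 + (norm (z' - z))\<^sup>2)"
    using damp pos by (intro mult_left_mono) auto
  moreover have "1 / \<eta> * (norm (z' - zs))\<^sup>2 = 1 / \<eta> * (norm (z - zs))\<^sup>2
      - 1 / \<eta> * (norm (z' - z))\<^sup>2 + 2 * (1 / \<eta> * ((z' - z) \<bullet> (z' - zs)))"
    unfolding three_point by (simp add: algebra_simps)
  moreover have "2 / \<sigma> = 2 * a" by (simp add: a_def)
  ultimately show ?thesis using model_terms unfolding move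
    by (simp add: algebra_simps)
qed

text \<open>The vector \<open>A z - s\<close> is an inexact value of \<open>A (z - zs)\<close>, and the difference is the error of \<open>s\<close>. If
  both the error and the displacement \<open>z' - z\<close> were zero, the left side would be
  \<open>- 2 \<beta> \<parallel>A (z' - zs)\<parallel>\<^sup>2\<close>. In general two cross terms are added, and half of this negative square
  absorbs each of them.\<close>

lemma coupling_correction:
  fixes A :: "real ^ 'n ^ 'm"
  assumes bound: "\<And>v. norm (A *v v) \<le> K * norm v"
    and \<beta>: "\<beta> > 0" "\<beta> * K\<^sup>2 \<le> N"
  shows "- 2 * (\<beta> *\<^sub>R (transpose A *v (A *v z - s)) \<bullet> (z' - zs))
    \<le> N * (norm (z' - z))\<^sup>2 + \<beta> * (norm (s - A *v zs))\<^sup>2"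
proof -
  define u where "u = A *v (z' - zs)"
  define v where "v = A *v (z' - z)"
  define t where "t = s - A *v zs"
  have "(transpose A *v (A *v z - s)) \<bullet> (z' - zs) = (u - v - t) \<bullet> u"
    unfolding inner_transpose_matrix u_def v_def t_def
    by (simp add: matrix_vector_mult_diff_distrib)
  moreover have "- 2 * ((u - v - t) \<bullet> u) \<le> (norm v)\<^sup>2 + (norm t)\<^sup>2"
  proof -
    have "(norm v)\<^sup>2 + (norm t)\<^sup>2 + 2 * ((u - v - t) \<bullet> u) = (norm (u - v))\<^sup>2 + (norm (u - t))\<^sup>2"
      by (simp add: power2_norm_eq_inner inner_diff_left inner_diff_right inner_commute)
    then show ?thesis using zero_le_power2[of "norm (u - v)"] zero_le_power2[of "norm (u - t)"]
      by linarith
  qed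
  ultimately have "\<beta> * (- 2 * ((transpose A *v (A *v z - s)) \<bullet> (z' - zs)))
      \<le> \<beta> * ((norm v)\<^sup>2 + (norm t)\<^sup>2)"
    using \<beta> by (intro mult_left_mono) auto
  moreover have "\<beta> * (norm v)\<^sup>2 \<le> N * (norm (z' - z))\<^sup>2"
  proof -
    have "(norm v)\<^sup>2 \<le> (K * norm (z' - z))\<^sup>2"
      unfolding v_def by (intro power_mono bound) simp
    then have "\<beta> * (norm v)\<^sup>2 \<le> \<beta> * (K * norm (z' - z))\<^sup>2"
      using \<beta> by (intro mult_left_mono) auto
    also have "\<dots> = \<beta> * K\<^sup>2 * (norm (z' - z))\<^sup>2" by (simp add: power_mult_distrib)
    also have "\<dots> \<le> N * (norm (z' - z))\<^sup>2" by (intro mult_right_mono \<beta>) simp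
    finally show ?thesis .
  qed
  ultimately show ?thesis by (simp add: t_def algebra_simps)
qed

lemma saddle_point_gradients:
  fixes A :: "real ^ 'n ^ 'm"
  assumes saddle: "saddle_point (\<lambda>x y. f x + y \<bullet> (A *v x) - g y) xs ys"
    and diff: "f differentiable at xs" "g differentiable at ys"
  shows "gradient f xs = - (transpose A *v ys)" and "gradient g ys = A *v xs"
proof -
  have F: "f xs + y' \<bullet> (A *v xs) - g y' \<le> f xs + ys \<bullet> (A *v xs) - g ys"
    "f xs + ys \<bullet> (A *v xs) - g ys \<le> f x' + ys \<bullet> (A *v x') - g ys" for x' y'
    using saddle unfolding saddle_point_def by blast+
  show "gradient f xs = - (transpose A *v ys)"
  proof (rule gradient_eq_at_minimum)
    show "f xs - - (transpose A *v ys) \<bullet> xs \<le> f z - - (transpose A *v ys) \<bullet> z" for z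
      using F(2)[of z] unfolding inner_minus_left inner_transpose_matrix by simp
  qed fact
  show "gradient g ys = A *v xs"
  proof (rule gradient_eq_at_minimum)
    show "g ys - (A *v xs) \<bullet> ys \<le> g z - (A *v xs) \<bullet> z" for z
      using F(1)[of z] by (simp add: inner_commute)
  qed fact
qed

lemma perturbed_linear_decay:
  fixes V :: "nat \<Rightarrow> real"
  assumes step: "\<And>k. V (Suc k) \<le> q * V k + E" and q: "0 \<le> q" "q < 1" and "E \<ge> 0"
  shows "V k \<le> q ^ k * V 0 + E / (1 - q)"
proof (induction k)
  case 0
  then show ?case using assms by simp
next
  case (Suc k)
  have "V (Suc k) \<le> q * V k + E" by (rule step)
  also have "\<dots> \<le> q * (q ^ k * V 0 + E / (1 - q)) + E"
    using Suc q by (intro add_right_mono mult_left_mono) auto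
  also have "\<dots> = q ^ Suc k * V 0 + E / (1 - q)" using q by (simp add: field_simps)
  finally show ?case .
qed

section \<open>The energy of the coupled iteration\<close>

text \<open>The last two terms carry the extrapolation lag: the first telescopes against the lag of the next
  iterate, and the second keeps the sum of both terms and \<open>P \<parallel>x - xs\<parallel>\<^sup>2\<close> nonnegative for \<open>P = K\<^sup>2 / Q\<close>,
  where \<open>K\<close> bounds the norm of \<open>A\<close>. The
  coefficient \<open>4 * M\<close> of the divergences is \<open>2 / \<sigma>\<close>.\<close>

definition apdg_energy where
  "apdg_energy M A Q \<mu>x \<mu>y f g xs ys x y yprev xf yf =
     4 * M * \<mu>x * (norm (x - xs))\<^sup>2 + 4 * M * \<mu>y * (norm (y - ys))\<^sup>2
     + 4 * M * (bregman f xf xs + bregman g yf ys)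
     - 2 * ((y - yprev) \<bullet> (A *v (x - xs))) + Q * (norm (y - yprev))\<^sup>2"

text \<open>The factor \<open>\<theta>\<close> is exact for distances and divergences alike:
  \<open>1 / \<eta> - \<mu> = \<theta> / \<eta>\<close> and \<open>2 / \<sigma> - 1 = \<theta> (2 / \<sigma>)\<close>. The coefficients of \<open>\<parallel>x' - x\<parallel>\<^sup>2\<close> and \<open>\<parallel>y' - y\<parallel>\<^sup>2\<close>
  have to absorb the coupling constant twice, once for the correction with factor \<open>\<beta>\<close> and once for the lag.\<close>

lemma apdg_energy_step:
  fixes A :: "real ^ 'n ^ 'm" and f :: "real ^ 'n \<Rightarrow> real" and g :: "real ^ 'm \<Rightarrow> real"
  assumes model_f: "is_model \<delta>x Lx \<mu>x f xg sf" and model_g: "is_model \<delta>y Ly \<mu>y g yg sg"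
    and conv: "strongly_convex \<mu>x f" "strongly_convex \<mu>y g"
    and \<mu>: "\<mu>x > 0" "\<mu>y > 0"
    and M: "M \<ge> 1" "Lx \<le> M\<^sup>2 * \<mu>x" "Ly \<le> M\<^sup>2 * \<mu>y"
    and bound: "\<And>v. norm (A *v v) \<le> K * norm v"
    and PQ: "P > 0" "Q > 0" "P * Q = K\<^sup>2" "P \<le> M * \<mu>x" "Q \<le> M * \<mu>y"
    and \<beta>x: "\<beta>x > 0" "\<beta>x * K\<^sup>2 \<le> P" "2 * Ly * \<beta>x \<le> 1"
    and \<beta>y: "\<beta>y > 0" "\<beta>y * K\<^sup>2 \<le> Q" "2 * Lx * \<beta>y \<le> 1"
    and opt: "gradient f xs = - (transpose A *v ys)" "gradient g ys = A *v xs"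
    and \<sigma>: "\<sigma> = 1 / (2 * M)" and \<tau>: "\<tau> = 2 / (4 * M + 1)" and \<theta>: "\<theta> = 1 - 1 / (4 * M)"
    and \<eta>x: "\<eta>x = 1 / (4 * M * \<mu>x)" and \<eta>y: "\<eta>y = 1 / (4 * M * \<mu>y)"
    and xg: "xg = \<tau> *\<^sub>R x + (1 - \<tau>) *\<^sub>R xf" and yg: "yg = \<tau> *\<^sub>R y + (1 - \<tau>) *\<^sub>R yf"
    and ym: "ym = y + \<theta> *\<^sub>R (y - yprev)"
    and x': "x' = x + (\<eta>x * \<mu>x) *\<^sub>R (xg - x) - (\<eta>x * \<beta>x) *\<^sub>R (transpose A *v (A *v x - sg))
      - \<eta>x *\<^sub>R (sf + transpose A *v ym)"
    and y': "y' = y + (\<eta>y * \<mu>y) *\<^sub>R (yg - y) - (\<eta>y * \<beta>y) *\<^sub>R (A *v (transpose A *v y + sf))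
      - \<eta>y *\<^sub>R (sg - A *v x')"
    and xf': "xf' = xg + \<sigma> *\<^sub>R (x' - x)" and yf': "yf' = yg + \<sigma> *\<^sub>R (y' - y)"
  shows "apdg_energy M A Q \<mu>x \<mu>y f g xs ys x' y' y xf' yf'
    \<le> \<theta> * apdg_energy M A Q \<mu>x \<mu>y f g xs ys x y yprev xf yf + (4 * M + 2) * (\<delta>x + \<delta>y)"
proof -
  define wx where "wx = \<beta>x *\<^sub>R (transpose A *v (A *v x - sg)) + transpose A *v (ym - ys)"
  define wy where "wy = \<beta>y *\<^sub>R (A *v (transpose A *v y + sf)) - A *v (x' - xs)"
  have params: "0 < \<sigma>" "\<sigma> \<le> 1" "0 < \<tau>" "1 / \<tau> = 1 / \<sigma> + 1 / 2" "0 < \<eta>x" "0 < \<eta>y"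
    "2 / \<sigma> = 4 * M" "1 / \<eta>x = 4 * M * \<mu>x" "1 / \<eta>y = 4 * M * \<mu>y" "0 \<le> \<theta>" "\<theta> \<le> 1"
    using M \<mu> by (auto simp: \<sigma> \<tau> \<eta>x \<eta>y \<theta> field_simps)
  have M\<theta>: "M * \<theta> = M - 1 / 4" using M by (simp add: \<theta> field_simps)
  have upd_x: "x' = x + (\<eta>x * \<mu>x) *\<^sub>R (xg - x) - \<eta>x *\<^sub>R (sf - gradient f xs) - \<eta>x *\<^sub>R wx"
    unfolding x' wx_def opt by (simp only: matrix_vector_mult_diff_distrib) (simp add: algebra_simps)
  have upd_y: "y' = y + (\<eta>y * \<mu>y) *\<^sub>R (yg - y) - \<eta>y *\<^sub>R (sg - gradient g ys) - \<eta>y *\<^sub>R wy"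
    unfolding y' wy_def opt by (simp only: matrix_vector_mult_diff_distrib) (simp add: algebra_simps)
  have step_x: "4 * M * \<mu>x * (norm (x' - xs))\<^sup>2 + 4 * M * bregman f xf' xs
    \<le> (4 * M * \<mu>x - \<mu>x) * (norm (x - xs))\<^sup>2 + (4 * M - 1) * bregman f xf xs
      - (4 * M * \<mu>x - \<mu>x - Lx * \<sigma>) * (norm (x' - x))\<^sup>2 - bregman f xg xs + (4 * M + 1) * \<delta>x
      - 2 * (wx \<bullet> (x' - xs))"
    using accelerated_step[OF model_f \<mu>(1) params(1-3,5,4) xg upd_x xf'] unfolding params(7-9) .
  have step_y: "4 * M * \<mu>y * (norm (y' - ys))\<^sup>2 + 4 * M * bregman g yf' ys
    \<le> (4 * M * \<mu>y - \<mu>y) * (norm (y - ys))\<^sup>2 + (4 * M - 1) * bregman g yf ys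
      - (4 * M * \<mu>y - \<mu>y - Ly * \<sigma>) * (norm (y' - y))\<^sup>2 - bregman g yg ys + (4 * M + 1) * \<delta>y
      - 2 * (wy \<bullet> (y' - ys))"
    using accelerated_step[OF model_g \<mu>(2) params(1-3,6,4) yg upd_y yf'] unfolding params(7-9) .

  have model_error: "\<beta> * (norm (s - gradient h z))\<^sup>2 \<le> bregman h zg z + \<delta>"
    if "is_model \<delta> L \<nu> h zg s" "strongly_convex \<nu> h" "\<nu> > 0" "\<beta> > 0" "2 * L * \<beta> \<le> 1"
    for \<beta> \<delta> L \<nu> and h :: "'z::euclidean_space \<Rightarrow> real" and zg z s
  proof -
    have *: "(norm (s - gradient h z))\<^sup>2 \<le> 2 * L * (bregman h zg z + \<delta>)"
      by (rule model_gradient_error) fact+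
    have L: "0 < L" using model_curvature_le[OF that(1)] that by simp
    have "0 \<le> 2 * L * (bregman h zg z + \<delta>)" using * zero_le_power2 order_trans by blast
    then have nonneg: "0 \<le> bregman h zg z + \<delta>" using L by (simp add: zero_le_mult_iff)
    have "\<beta> * (norm (s - gradient h z))\<^sup>2 \<le> \<beta> * (2 * L * (bregman h zg z + \<delta>))"
      using * that by (intro mult_left_mono) auto
    also have "\<dots> = 2 * L * \<beta> * (bregman h zg z + \<delta>)" by simp
    also have "\<dots> \<le> 1 * (bregman h zg z + \<delta>)"
      using that nonneg by (intro mult_right_mono) auto
    finally show ?thesis by simp
  qed
  \<comment> \<open>The gradient error of each block is charged to the correction term of the other block.\<close>
  have err_x: "\<beta>y * (norm (sf - gradient f xs))\<^sup>2 \<le> bregman f xg xs + \<delta>x"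
    by (rule model_error) fact+
  have err_y: "\<beta>x * (norm (sg - gradient g ys))\<^sup>2 \<le> bregman g yg ys + \<delta>y"
    by (rule model_error) fact+

  have corr_x: "- 2 * (\<beta>x *\<^sub>R (transpose A *v (A *v x - sg)) \<bullet> (x' - xs))
      \<le> P * (norm (x' - x))\<^sup>2 + \<beta>x * (norm (sg - gradient g ys))\<^sup>2"
    unfolding opt by (rule coupling_correction[OF bound]) fact+
  \<comment> \<open>The optimality condition for \<open>x\<close> reads \<open>A\<^sup>T ys = - \<nabla>f(xs)\<close>, hence the sign of \<open>s\<close>.\<close>
  have corr_y: "- 2 * (\<beta>y *\<^sub>R (A *v (transpose A *v y + sf)) \<bullet> (y' - ys))
      \<le> Q * (norm (y' - y))\<^sup>2 + \<beta>y * (norm (sf - gradient f xs))\<^sup>2"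
    using coupling_correction[of "transpose A", OF norm_transpose_le[OF bound] \<beta>y(1,2),
        where s = "- sf" and z = y and z' = y' and zs = ys]
      norm_minus_cancel[of "sf + transpose A *v ys"]
    unfolding opt transpose_transpose by (simp add: norm_minus_commute)

  \<comment> \<open>The terms in \<open>y' - ys\<close> of the two blocks cancel, which leaves the new lag \<open>c'\<close>, the old lag \<open>c\<close>
    with factor \<open>\<theta>\<close>, and the remainder \<open>e\<close>.\<close>
  define c' where "c' = (y' - y) \<bullet> (A *v (x' - xs))"
  define c where "c = (y - yprev) \<bullet> (A *v (x - xs))"
  define e where "e = (y - yprev) \<bullet> (A *v (x' - x))"
  have "(ym - ys) \<bullet> (A *v (x' - xs)) = (y' - ys) \<bullet> (A *v (x' - xs)) - c' + \<theta> * (c + e)"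
  proof -
    have "A *v (x' - xs) = A *v (x - xs) + A *v (x' - x)"
      by (simp add: matrix_vector_mult_diff_distrib)
    then have ce: "c + e = (y - yprev) \<bullet> (A *v (x' - xs))" unfolding c_def e_def
      by (simp add: inner_add_right)
    show ?thesis unfolding ce ym c'_def
      by (simp add: inner_diff_left inner_add_left algebra_simps)
  qed
  then have wx: "wx \<bullet> (x' - xs) = \<beta>x *\<^sub>R (transpose A *v (A *v x - sg)) \<bullet> (x' - xs)
      + ((y' - ys) \<bullet> (A *v (x' - xs)) - c' + \<theta> * (c + e))"
    unfolding wx_def inner_add_left inner_transpose_matrix by simp
  have wy: "wy \<bullet> (y' - ys) = \<beta>y *\<^sub>R (A *v (transpose A *v y + sf)) \<bullet> (y' - ys)
      - (y' - ys) \<bullet> (A *v (x' - xs))"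
    unfolding wy_def inner_diff_left[of _ _ "y' - ys"]
    by (simp only: inner_commute[of "A *v (x' - xs)"])
  have "- 2 * e \<le> P * (norm (x' - x))\<^sup>2 + Q * (norm (y - yprev))\<^sup>2"
    using coupling_bound[OF bound PQ(1-3), of "y - yprev" "x' - x"] unfolding e_def by linarith
  then have "\<theta> * (- 2 * e) \<le> \<theta> * (P * (norm (x' - x))\<^sup>2 + Q * (norm (y - yprev))\<^sup>2)"
    using params by (intro mult_left_mono) auto
  also have "\<dots> \<le> P * (norm (x' - x))\<^sup>2 + \<theta> * (Q * (norm (y - yprev))\<^sup>2)"
    using params PQ by (simp add: distrib_left mult_left_le_one_le)
  finally have lag: "- 2 * (\<theta> * e) \<le> P * (norm (x' - x))\<^sup>2 + \<theta> * (Q * (norm (y - yprev))\<^sup>2)"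
    by simp

  have smooth: "L * \<sigma> \<le> M * \<nu> / 2" if "L \<le> M\<^sup>2 * \<nu>" for L \<nu>
  proof -
    have "L * \<sigma> \<le> M\<^sup>2 * \<nu> * \<sigma>" using that params by (intro mult_right_mono) auto
    also have "\<dots> = M * \<nu> / 2" using M by (simp add: \<sigma> power2_eq_square)
    finally show ?thesis .
  qed
  have absorb: "0 \<le> (4 * M * \<nu> - \<nu> - L * \<sigma> - R - R) * r\<^sup>2"
    if "L \<le> M\<^sup>2 * \<nu>" "R \<le> M * \<nu>" "\<nu> > 0" for L \<nu> R r
  proof -
    \<comment> \<open>The coefficient is at least \<open>(4 - 1 - 1/2 - 1 - 1) M \<nu>\<close>.\<close>
    have "\<nu> \<le> M * \<nu>" using that M by simp
    then have "0 \<le> 4 * M * \<nu> - \<nu> - L * \<sigma> - R - R" using smooth[OF that(1)] that by linarith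
    then show ?thesis by simp
  qed
  have absorb_x: "0 \<le> (4 * M * \<mu>x - \<mu>x - Lx * \<sigma> - P - P) * (norm (x' - x))\<^sup>2"
    by (rule absorb) fact+
  have absorb_y: "0 \<le> (4 * M * \<mu>y - \<mu>y - Ly * \<sigma> - Q - Q) * (norm (y' - y))\<^sup>2"
    by (rule absorb) fact+

  have "\<theta> * apdg_energy M A Q \<mu>x \<mu>y f g xs ys x y yprev xf yf
      = 4 * (M * \<theta>) * \<mu>x * (norm (x - xs))\<^sup>2 + 4 * (M * \<theta>) * \<mu>y * (norm (y - ys))\<^sup>2
        + 4 * (M * \<theta>) * (bregman f xf xs + bregman g yf ys) - 2 * (\<theta> * c)
        + \<theta> * (Q * (norm (y - yprev))\<^sup>2)"
    unfolding apdg_energy_def c_def by (simp add: algebra_simps)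
  then have old: "\<theta> * apdg_energy M A Q \<mu>x \<mu>y f g xs ys x y yprev xf yf
      = (4 * M * \<mu>x - \<mu>x) * (norm (x - xs))\<^sup>2 + (4 * M * \<mu>y - \<mu>y) * (norm (y - ys))\<^sup>2
        + (4 * M - 1) * (bregman f xf xs + bregman g yf ys) - 2 * (\<theta> * c)
        + \<theta> * (Q * (norm (y - yprev))\<^sup>2)"
    unfolding M\<theta> by (simp add: algebra_simps)
  show ?thesis
    using step_x step_y err_x err_y corr_x corr_y lag absorb_x absorb_y
    unfolding old wx wy unfolding apdg_energy_def c'_def[symmetric]
      distrib_left distrib_right left_diff_distrib right_diff_distrib
    by linarith
qed

text \<open>Of the weight \<open>4M\<mu>\<^sub>x \<ge> 4P\<close> one unit \<open>P\<close>, together with \<open>Q \<parallel>y - yprev\<parallel>\<^sup>2\<close>, compensates the indefinite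
  lag term, which is why the constants of
  the two blocks differ.\<close>

lemma apdg_energy_lower_bound:
  fixes A :: "real ^ 'n ^ 'm"
  assumes bound: "\<And>v. norm (A *v v) \<le> K * norm v"
    and PQ: "P > 0" "Q > 0" "P * Q = K\<^sup>2" "P \<le> M * \<mu>x" "Q \<le> M * \<mu>y" and "M \<ge> 0"
    and conv: "strongly_convex \<mu>x f" "strongly_convex \<mu>y g" "\<mu>x \<ge> 0" "\<mu>y \<ge> 0"
  shows "3 * P * (norm (x - xs))\<^sup>2 + 4 * Q * (norm (y - ys))\<^sup>2
    \<le> apdg_energy M A Q \<mu>x \<mu>y f g xs ys x y yprev xf yf"
proof -
  have "2 * \<bar>(y - yprev) \<bullet> (A *v (x - xs))\<bar>
      \<le> P * (norm (x - xs))\<^sup>2 + Q * (norm (y - yprev))\<^sup>2"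
    by (rule coupling_bound[OF bound PQ(1-3)])
  moreover have "0 \<le> 4 * M * (bregman f xf xs + bregman g yf ys)"
    using bregman_nonneg[OF conv(1,3)] bregman_nonneg[OF conv(2,4)] \<open>M \<ge> 0\<close> by simp
  moreover have "P * (norm (x - xs))\<^sup>2 \<le> M * \<mu>x * (norm (x - xs))\<^sup>2"
    using PQ by (intro mult_right_mono) auto
  moreover have "Q * (norm (y - ys))\<^sup>2 \<le> M * \<mu>y * (norm (y - ys))\<^sup>2"
    using PQ by (intro mult_right_mono) auto
  ultimately show ?thesis unfolding apdg_energy_def by linarith
qed

theorem theorem2p2:
  fixes f :: "real ^ 'n \<Rightarrow> real"
    and g :: "real ^ 'm \<Rightarrow> real"
    and A :: "real ^ 'n ^ 'm"
    and f\<delta> :: "real ^ 'n \<Rightarrow> real ^ 'n"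
    and g\<delta> :: "real ^ 'm \<Rightarrow> real ^ 'm"
    and Lx Ly \<mu>x \<mu>y Lxy \<mu>xy \<mu>yx \<delta>x \<delta>y :: real
    and xs :: "real ^ 'n"
    and ys :: "real ^ 'm"
  assumes "\<mu>x > 0" and "\<mu>y > 0"
    and "strongly_convex \<mu>x f" and "L_smooth Lx f"
    and "strongly_convex \<mu>y g" and "L_smooth Ly g"
    and "Lxy > 0" and "\<mu>xy \<ge> 0" and "\<mu>yx \<ge> 0"
    and "coupling_assumption A f g f\<delta> g\<delta> Lxy \<mu>xy \<mu>yx"
    and "saddle_point (\<lambda>x y. f x + y \<bullet> (A *v x) - g y) xs ys"
    and "\<delta>x \<ge> 0" and "\<delta>y \<ge> 0"
    and "\<And>x. is_model \<delta>x Lx \<mu>x f x (f\<delta> x)"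
    and "\<And>y. is_model \<delta>y Ly \<mu>y g y (g\<delta> y)"
  shows "\<exists>p. admissible_params p \<and>
    (\<forall>x y xf yf. inexact_apdg p A f\<delta> g\<delta> x y xf yf \<longrightarrow>
      (\<forall>k.
        (norm (x k - xs))\<^sup>2 \<le> 1 / (3 * Lxy) * sqrt (\<mu>y / \<mu>x) *
          (theta p ^ k * Psi0 p f g (x 0) (y 0) xs ys + 4 / (1 - theta p)\<^sup>2 * (\<delta>x + \<delta>y)) \<and>
        (norm (y k - ys))\<^sup>2 \<le> 1 / (4 * Lxy) * sqrt (\<mu>x / \<mu>y) *
          (theta p ^ k * Psi0 p f g (x 0) (y 0) xs ys + 4 / (1 - theta p)\<^sup>2 * (\<delta>x + \<delta>y)))) \<and>
    1 / (1 - theta p) \<le>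
      4 + 4 * Max {sqrt (Lx / \<mu>x), sqrt (Ly / \<mu>y), Lxy / sqrt (\<mu>x * \<mu>y)}"
proof -
  note \<mu> = assms(1,2)
  note conv = assms(3,5)
  note model_f = assms(14) and model_g = assms(15)
  note Lxy = \<open>Lxy > 0\<close>
  define M where "M = Max {sqrt (Lx / \<mu>x), sqrt (Ly / \<mu>y), Lxy / sqrt (\<mu>x * \<mu>y)}"
  define P where "P = Lxy * sqrt (\<mu>x / \<mu>y)"
  define Q where "Q = Lxy * sqrt (\<mu>y / \<mu>x)"
  have M_ge: "sqrt (Lx / \<mu>x) \<le> M" "sqrt (Ly / \<mu>y) \<le> M" "Lxy / sqrt (\<mu>x * \<mu>y) \<le> M"
    by (auto simp: M_def)
  have L: "\<mu>x \<le> Lx" "\<mu>y \<le> Ly"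
    using model_curvature_le[OF model_f] model_curvature_le[OF model_g] by auto
  have "1 \<le> sqrt (Lx / \<mu>x)" using L \<mu> by simp
  then have M1: "M \<ge> 1" using M_ge by linarith
  have Lx_Ly_le: "Lx \<le> M\<^sup>2 * \<mu>x" "Ly \<le> M\<^sup>2 * \<mu>y"
    using M_ge(1,2)[THEN sqrt_le_D] \<mu> by (auto simp: field_simps)
  have Lxy_le: "Lxy \<le> M * (sqrt \<mu>x * sqrt \<mu>y)"
    using M_ge(3) \<mu> by (simp add: real_sqrt_mult field_simps)
  have PQ: "P > 0" "Q > 0" "P * Q = Lxy\<^sup>2"
    using Lxy \<mu> by (auto simp: P_def Q_def real_sqrt_divide power2_eq_square)
  have "P \<le> M * (sqrt \<mu>x * sqrt \<mu>y) * sqrt (\<mu>x / \<mu>y)"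
    unfolding P_def using Lxy_le \<mu> by (intro mult_right_mono) auto
  also have "\<dots> = M * \<mu>x" using \<mu> by (simp add: real_sqrt_divide)
  finally have P_le: "P \<le> M * \<mu>x" .
  have "Q \<le> M * (sqrt \<mu>x * sqrt \<mu>y) * sqrt (\<mu>y / \<mu>x)"
    unfolding Q_def using Lxy_le \<mu> by (intro mult_right_mono) auto
  also have "\<dots> = M * \<mu>y" using \<mu> by (simp add: real_sqrt_divide)
  finally have Q_le: "Q \<le> M * \<mu>y" .
  have bound: "norm (A *v v) \<le> Lxy * norm v" for v
    using assms(10) Lxy by (intro norm_matrix_le_of_lambda_max) (auto simp: coupling_assumption_def)
  have opt: "gradient f xs = - (transpose A *v ys)" "gradient g ys = A *v xs"
    using saddle_point_gradients[OF assms(11)] conv by (auto simp: strongly_convex_def)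

  \<comment> \<open>The first bound lets the other block pay for its gradient error, the second keeps the correction
    within the coupling constant.\<close>
  define \<beta>x where "\<beta>x = min (1 / (2 * Ly)) (P / Lxy\<^sup>2)"
  define \<beta>y where "\<beta>y = min (1 / (2 * Lx)) (Q / Lxy\<^sup>2)"
  have small_step: "0 < min (1 / (2 * l)) (R / c\<^sup>2) \<and> min (1 / (2 * l)) (R / c\<^sup>2) * c\<^sup>2 \<le> R
      \<and> 2 * l * min (1 / (2 * l)) (R / c\<^sup>2) \<le> 1" if "0 < l" "0 < R" "0 < c" for l R c :: real
  proof -
    have "min (1 / (2 * l)) (R / c\<^sup>2) * c\<^sup>2 \<le> R / c\<^sup>2 * c\<^sup>2" by (intro mult_right_mono) auto
    moreover have "2 * l * min (1 / (2 * l)) (R / c\<^sup>2) \<le> 2 * l * (1 / (2 * l))"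
      using that by (intro mult_left_mono) auto
    ultimately show ?thesis using that by simp
  qed
  have \<beta>x: "\<beta>x > 0" "\<beta>x * Lxy\<^sup>2 \<le> P" "2 * Ly * \<beta>x \<le> 1"
    using small_step[of Ly P Lxy] L \<mu> PQ Lxy by (auto simp: \<beta>x_def)
  have \<beta>y: "\<beta>y > 0" "\<beta>y * Lxy\<^sup>2 \<le> Q" "2 * Lx * \<beta>y \<le> 1"
    using small_step[of Lx Q Lxy] L \<mu> PQ Lxy by (auto simp: \<beta>y_def)

  define \<theta> where "\<theta> = 1 - 1 / (4 * M)"
  have \<theta>: "0 < \<theta>" "\<theta> < 1" "1 / (1 - \<theta>) = 4 * M" using M1 by (auto simp: \<theta>_def)
  define p where "p = \<lparr>eta_x = 1 / (4 * M * \<mu>x), eta_y = 1 / (4 * M * \<mu>y), alpha_x = \<mu>x,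
    alpha_y = \<mu>y, beta_x = \<beta>x, beta_y = \<beta>y, tau_x = 2 / (4 * M + 1), tau_y = 2 / (4 * M + 1),
    sigma_x = 1 / (2 * M), sigma_y = 1 / (2 * M), theta = \<theta>\<rparr>"
  have p_simps [simp]: "eta_x p = 1 / (4 * M * \<mu>x)" "eta_y p = 1 / (4 * M * \<mu>y)" "alpha_x p = \<mu>x"
    "alpha_y p = \<mu>y" "beta_x p = \<beta>x" "beta_y p = \<beta>y" "tau_x p = 2 / (4 * M + 1)"
    "tau_y p = 2 / (4 * M + 1)" "sigma_x p = 1 / (2 * M)" "sigma_y p = 1 / (2 * M)" "theta p = \<theta>"
    by (simp_all add: p_def)
  have "admissible_params p"
    using M1 \<mu> \<beta>x \<beta>y \<theta> by (auto simp: admissible_params_def)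
  moreover have "1 / (1 - theta p) \<le> 4 + 4 * M" using \<theta> by simp
  moreover have "(norm (x k - xs))\<^sup>2 \<le> 1 / (3 * Lxy) * sqrt (\<mu>y / \<mu>x) *
          (theta p ^ k * Psi0 p f g (x 0) (y 0) xs ys + 4 / (1 - theta p)\<^sup>2 * (\<delta>x + \<delta>y)) \<and>
        (norm (y k - ys))\<^sup>2 \<le> 1 / (4 * Lxy) * sqrt (\<mu>x / \<mu>y) *
          (theta p ^ k * Psi0 p f g (x 0) (y 0) xs ys + 4 / (1 - theta p)\<^sup>2 * (\<delta>x + \<delta>y))"
    if run: "inexact_apdg p A f\<delta> g\<delta> x y xf yf" for x y xf yf k
  proof -
    define yp where "yp i = (if i = 0 then y 0 else y (i - 1))" for i
    define V where "V i = apdg_energy M A Q \<mu>x \<mu>y f g xs ys (x i) (y i) (yp i) (xf i) (yf i)" for i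
    define E where "E = (4 * M + 2) * (\<delta>x + \<delta>y)"
    define R where "R = theta p ^ k * Psi0 p f g (x 0) (y 0) xs ys + 4 / (1 - theta p)\<^sup>2 * (\<delta>x + \<delta>y)"
    have "V (Suc i) \<le> \<theta> * V i + E" for i
    proof -
      note upd = run[unfolded inexact_apdg_def Let_def p_simps, folded yp_def,
          THEN conjunct2, THEN conjunct2, THEN conjunct2, THEN conjunct2, rule_format, of i]
      have yp_Suc: "yp (Suc i) = y i" by (simp add: yp_def)
      show ?thesis unfolding V_def E_def yp_Suc
        by (rule apdg_energy_step[OF model_f model_g conv \<mu> M1 Lx_Ly_le bound PQ P_le Q_le \<beta>x \<beta>y opt
            refl refl \<theta>_def refl refl refl refl refl
            upd[THEN conjunct1] upd[THEN conjunct2, THEN conjunct1]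
            upd[THEN conjunct2, THEN conjunct2, THEN conjunct1]
            upd[THEN conjunct2, THEN conjunct2, THEN conjunct2]])
    qed
    then have "V k \<le> \<theta> ^ k * V 0 + E / (1 - \<theta>)"
      using \<theta> M1 assms(12,13) by (intro perturbed_linear_decay) (auto simp: E_def)
    also have "V 0 = Psi0 p f g (x 0) (y 0) xs ys"
    proof -
      have "xf 0 = x 0" "yf 0 = y 0" using run unfolding inexact_apdg_def by blast+
      then show ?thesis by (simp add: V_def apdg_energy_def Psi0_def yp_def distrib_left)
    qed
    also have "E / (1 - \<theta>) \<le> 4 / (1 - theta p)\<^sup>2 * (\<delta>x + \<delta>y)"
    proof -
      have "E / (1 - \<theta>) = 4 * M * E" unfolding \<theta>(3)[symmetric] by simp
      also have "\<dots> = (4 * M + 2) * (4 * M * (\<delta>x + \<delta>y))" by (simp add: E_def)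
      also have "\<dots> \<le> (16 * M) * (4 * M * (\<delta>x + \<delta>y))"
        using M1 assms(12,13) by (intro mult_right_mono) auto
      also have "\<dots> = 4 * (1 / (1 - \<theta>))\<^sup>2 * (\<delta>x + \<delta>y)"
        unfolding \<theta>(3) by (simp add: power2_eq_square)
      finally show ?thesis by (simp add: power_divide)
    qed
    finally have "V k \<le> R" by (simp add: R_def)
    moreover have "3 * P * (norm (x k - xs))\<^sup>2 + 4 * Q * (norm (y k - ys))\<^sup>2 \<le> V k"
      unfolding V_def using M1 \<mu> by (intro apdg_energy_lower_bound[OF bound PQ P_le Q_le _ conv]) auto
    moreover have "0 \<le> 3 * P * (norm (x k - xs))\<^sup>2" "0 \<le> 4 * Q * (norm (y k - ys))\<^sup>2"
      using PQ by auto
    ultimately have "3 * P * (norm (x k - xs))\<^sup>2 \<le> R" "4 * Q * (norm (y k - ys))\<^sup>2 \<le> R"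
      by linarith+
    then have "(norm (x k - xs))\<^sup>2 \<le> 1 / (3 * P) * R" "(norm (y k - ys))\<^sup>2 \<le> 1 / (4 * Q) * R"
      using PQ by (auto simp: field_simps)
    moreover have "1 / (3 * P) = 1 / (3 * Lxy) * sqrt (\<mu>y / \<mu>x)"
      "1 / (4 * Q) = 1 / (4 * Lxy) * sqrt (\<mu>x / \<mu>y)"
      using \<mu> Lxy by (auto simp: P_def Q_def real_sqrt_divide)
    ultimately show ?thesis unfolding R_def by simp
  qed
  ultimately show ?thesis unfolding M_def by blast
qed

end
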